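(* Let $n \ge 1$ and let $P(X_1,\ldots,X_n) = \sum_{S \subseteq [n]} c_S \prod_{i \in S} X_i$ be a multilinear real polynomial that sign represents the parity function over $\{0,1\}^n$. Then for every $S \subseteq [n]$, $\mathrm{sgn}(c_S) = (-1)^{|S|}$ (in particular every $c_S$ is nonzero).
   Context: $[n] = \{1,\ldots,n\}$. The parity function on $\{0,1\}^n$ is $\mathrm{Par}(a_1,\ldots,a_n) = \sum_i a_i \bmod 2$. A polynomial $P$ sign represents $f: \{0,1\}^n \to \{0,1\}$ if for every $a \in \{0,1\}^n$: $f(a) = 0 \Rightarrow P(a) > 0$ and $f(a) = 1 \Rightarrow P(a) < 0$. $\mathrm{sgn}(c) \in \{+1,-1,0\}$ according as $c$ is positive, negative or zero. *)

theory Defs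
  imports Complex_Main "HOL-Library.FuncSet"
begin

definition cube :: "nat \<Rightarrow> (nat \<Rightarrow> nat) set" where
  "cube n = {1..n} \<rightarrow>\<^sub>E {0, 1}"

definition parity :: "nat \<Rightarrow> (nat \<Rightarrow> nat) \<Rightarrow> nat" where
  "parity n a = (\<Sum>i\<in>{1..n}. a i) mod 2"

text \<open>A multilinear polynomial in the variables indexed by \<open>{1..n}\<close> is given by its
  coefficient family \<open>c\<close>; only the values of \<open>c\<close> on subsets of \<open>{1..n}\<close> matter.\<close>

definition multilinear_poly :: "nat \<Rightarrow> (nat set \<Rightarrow> real) \<Rightarrow> (nat \<Rightarrow> real) \<Rightarrow> real" where
  "multilinear_poly n c x = (\<Sum>S\<in>Pow {1..n}. c S * (\<Prod>i\<in>S. x i))"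

definition sign_represents ::
  "nat \<Rightarrow> ((nat \<Rightarrow> real) \<Rightarrow> real) \<Rightarrow> ((nat \<Rightarrow> nat) \<Rightarrow> nat) \<Rightarrow> bool" where
  "sign_represents n P f \<longleftrightarrow>
     (\<forall>a\<in>cube n. (f a = 0 \<longrightarrow> P (\<lambda>i. real (a i)) > 0) \<and>
                 (f a = 1 \<longrightarrow> P (\<lambda>i. real (a i)) < 0))"

end

theory Submission
  imports Defs
begin

text \<open>At the indicator vector of \<open>T\<close> the polynomial takes the value \<open>\<Sum>S \<in> Pow T. c S\<close>, which has
  sign \<open>(-1) ^ card T\<close>. Moebius inversion over the subset lattice writes \<open>(-1) ^ card S * c S\<close>
  as the sum over \<open>T \<subseteq> S\<close> of \<open>(-1) ^ card T\<close> times these values, all summands being positive.\<close>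

text \<open>The restricted lambda leaves the point \<open>undefined\<close> off
  \<open>{1..n}\<close>, as membership in the extensional function space \<open>cube n\<close>
  demands.\<close>

definition indicator_point :: "nat \<Rightarrow> nat set \<Rightarrow> nat \<Rightarrow> nat" where
  "indicator_point n T = (\<lambda>i\<in>{1..n}. of_bool (i \<in> T))"

lemma indicator_point_in_cube: "indicator_point n T \<in> cube n"
  by (auto simp: indicator_point_def cube_def)

lemma parity_indicator_point:
  assumes "T \<subseteq> {1..n}"
  shows "parity n (indicator_point n T) = card T mod 2"
proof -
  have "(\<Sum>i\<in>{1..n}. indicator_point n T i) = card ({1..n} \<inter> T)"
    by (simp add: indicator_point_def of_bool_def sum.If_cases Int_def)
  with assms show ?thesis
    by (simp add: parity_def Int_absorb1)
qed

text \<open>A monomial survives at this 0/1 point exactly when all its variables lie in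
  \<open>T\<close>; a single index outside \<open>T\<close> contributes a zero factor.\<close>

lemma multilinear_poly_indicator_point:
  assumes "T \<subseteq> {1..n}"
  shows "multilinear_poly n c (\<lambda>i. real (indicator_point n T i)) = (\<Sum>S\<in>Pow T. c S)"
proof -
  have "(\<Prod>i\<in>S. real (indicator_point n T i)) = of_bool (S \<subseteq> T)" if "S \<subseteq> {1..n}" for S
  proof -
    have "finite S"
      using that finite_subset by blast
    moreover have "(\<Prod>i\<in>S. real (indicator_point n T i)) = (\<Prod>i\<in>S. of_bool (i \<in> T))"
      using that by (intro prod.cong) (auto simp: indicator_point_def)
    ultimately show ?thesis
      by (cases "S \<subseteq> T") (auto intro!: prod.neutral)
  qed
  then have "multilinear_poly n c (\<lambda>i. real (indicator_point n T i))
      = (\<Sum>S\<in>Pow {1..n}. c S * of_bool (S \<subseteq> T))"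
    unfolding multilinear_poly_def by (intro sum.cong) auto
  also have "\<dots> = (\<Sum>S\<in>Pow T. c S)"
    using assms by (intro sum.mono_neutral_cong_right) auto
  finally show ?thesis .
qed

text \<open>The sign factor merges the even and odd cases of sign representation into one positivity
  statement, so that the values for different \<open>T\<close> can be added without
  cancellation.\<close>

lemma sum_subsets_sign_if_represents_parity:
  assumes "sign_represents n (multilinear_poly n c) (parity n)" and "T \<subseteq> {1..n}"
  shows "(-1) ^ card T * (\<Sum>S\<in>Pow T. c S) > 0"
proof -
  have "(card T mod 2 = 0 \<longrightarrow> (\<Sum>S\<in>Pow T. c S) > 0) \<and>
      (card T mod 2 = 1 \<longrightarrow> (\<Sum>S\<in>Pow T. c S) < 0)"
    using assms indicator_point_in_cube[of n T]
    unfolding sign_represents_def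
    by (metis parity_indicator_point multilinear_poly_indicator_point)
  then show ?thesis
    by (cases "even (card T)") (auto simp: even_iff_mod_2_eq_zero odd_iff_mod_2_eq_one)
qed

theorem theorem3p3:
  fixes n :: nat and c :: "nat set \<Rightarrow> real"
  assumes "n \<ge> 1"
    and "sign_represents n (multilinear_poly n c) (parity n)"
  shows "\<forall>S. S \<subseteq> {1..n} \<longrightarrow> sgn (c S) = (-1) ^ card S \<and> c S \<noteq> 0"
proof (intro allI impI)
  fix S :: "nat set"
  assume S: "S \<subseteq> {1..n}"
  then have "finite S"
    using finite_subset by blast
  \<comment> \<open>The symmetric form of inclusion-exclusion puts a sign in both directions. Taking
    the signed coefficient as \<open>f\<close> makes the signs in its premise square to 1, leaving
    the plain sum of \<open>c\<close> over subsets.\<close>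
  then have "(-1) ^ card S * c S = (\<Sum>T\<in>Pow S. (-1) ^ card T * (\<Sum>U\<in>Pow T. c U))"
    by (intro inclusion_exclusion_symmetric[where f = "\<lambda>S. (-1) ^ card S * c S"])
      (simp_all flip: mult.assoc power_add mult_2)
  \<comment> \<open>Every \<open>T\<close> in \<open>Pow S\<close> is again a subset of
    \<open>{1..n}\<close>, so each summand is positive, and \<open>Pow S\<close> is finite and
    nonempty.\<close>
  also have "\<dots> > 0"
    using S \<open>finite S\<close> sum_subsets_sign_if_represents_parity[OF assms(2)]
    by (intro sum_pos) auto
  finally have "(-1) ^ card S * c S > 0" .
  then show "sgn (c S) = (-1) ^ card S \<and> c S \<noteq> 0"
    by (cases "even (card S)") auto
qed

end
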